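(* Let the polynomial sequence $(b_0(x),b_1(x),\ldots)$ be defined by $b_0(x):=0$ and $b_k(x):=E_{2k-2}\big(\tfrac{x+1}{2}\big)$ for $k\ge1$, where $E_j(x)$ are the Euler polynomials. Then for all $n\ge1$, $$H_n\big(b_k(x)\big)=(-1)^{n-1}\frac{4}{n!^2(x^2-1)}\cdot\mathcal{K}_n(x)\cdot H_n\big(E_{2k}(\tfrac{x+1}{2})\big),$$ where $\mathcal{K}_1(x)=1$ and for $n\ge2$, $$\mathcal{K}_n(x):=1+\sum_{j=1}^{n-1}\frac{2^2}{3^2-x^2}\cdot\frac{4^2}{5^2-x^2}\cdots\frac{(2j)^2}{(2j+1)^2-x^2}.$$
   Context: For a sequence $(a_k)_{k\ge 0}$ and $n\ge 0$, $H_n(a_k):=\det(a_{i+j})_{0\le i,j\le n}$ denotes the $(n+1)\times(n+1)$ Hankel determinant; all sequences are indexed by $k\ge0$. The Euler polynomials are defined by $\frac{2e^{xt}}{e^t+1}=\sum_{n\ge0}E_n(x)\frac{t^n}{n!}$. Here $x$ is a variable, and the identity is one of rational functions in $x$. The notation $n!^2$ means $(n!)^2$. *)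

theory Defs
  imports
    "Jordan_Normal_Form.Determinant"
    "HOL-Computational_Algebra.Computational_Algebra"
begin

definition hankel_det :: "nat \<Rightarrow> (nat \<Rightarrow> 'a :: comm_ring_1) \<Rightarrow> 'a" where
  "hankel_det n a = det (mat (Suc n) (Suc n) (\<lambda>(i, j). a (i + j)))"

text \<open>
  The generating function \<open>2 e\<^sup>x\<^sup>t / (e\<^sup>t + 1)\<close> as a power series in \<open>t\<close> whose coefficients are
  polynomials in \<open>x\<close>. The factor \<open>2 / (e\<^sup>t + 1)\<close> is formed over the field, where power series
  division by a series with nonzero constant term is available, and then embedded
  coefficientwise; \<open>monom (1 / fact n) n\<close> is the coefficient \<open>x\<^sup>n / n!\<close> of \<open>e\<^sup>x\<^sup>t\<close>.
\<close>

definition euler_gf :: "'a :: field_char_0 poly fps" where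
  "euler_gf =
     Abs_fps (\<lambda>n. [:fps_nth (2 / (fps_exp 1 + 1)) n:]) * Abs_fps (\<lambda>n. monom (1 / fact n) n)"

definition euler_poly :: "nat \<Rightarrow> 'a :: field_char_0 poly" where
  "euler_poly n = smult (fact n) (fps_nth euler_gf n)"

definition euler_poly_half :: "nat \<Rightarrow> 'a :: field_char_0 poly" where
  "euler_poly_half n = pcompose (euler_poly n) [:1 / 2, 1 / 2:]"

definition b_seq :: "nat \<Rightarrow> 'a :: field_char_0 poly" where
  "b_seq k = (if k = 0 then 0 else euler_poly_half (2 * k - 2))"

text \<open>For \<open>n = 1\<close> the sum is empty, so that \<open>K_fun 1 x = 1\<close>; the value at \<open>n = 0\<close> is irrelevant.\<close>

definition K_fun :: "nat \<Rightarrow> 'a :: field \<Rightarrow> 'a" where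
  "K_fun n x =
     1 + (\<Sum>j = 1..n - 1. \<Prod>i = 1..j. of_nat (2 * i) ^ 2 / (of_nat (2 * i + 1) ^ 2 - x ^ 2))"

definition ratfun_X :: "'a :: field poly fract" where
  "ratfun_X = to_fract [:0, 1:]"

end

theory Submission
  imports Defs
begin

text \<open>
  Put \<open>b = (1 + x)/2\<close>, \<open>c = (1 - x)/2\<close> and let \<open>L\<close> be the linear functional on polynomials in \<open>y\<close> with
  \<open>L(y\<^sup>k) = E\<^bsub>2k\<^esub>(b)\<close>. The difference equation of the Euler polynomials shows that \<open>L\<close> takes the values
  \<open>(-1)\<^sup>k (b)\<^sub>k (c)\<^sub>k\<close> on the products \<open>\<Prod>\<^bsub>j<k\<^esub> (y - j\<^sup>2)\<close>, where \<open>(b)\<^sub>k\<close> is the rising factorial, so that both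
  \<open>L\<close> and \<open>p \<mapsto> L(y p)\<close> are functionals of continuous dual Hahn type, whose orthogonal polynomials
  and norms are explicit. This evaluates \<open>H\<^sub>n(E\<^bsub>2k\<^esub>)\<close> and \<open>H\<^bsub>n-1\<^esub>(E\<^bsub>2k+2\<^esub>)\<close> as products.
  The matrix of \<open>H\<^sub>n(b\<^sub>k)\<close> is the one of \<open>H\<^bsub>n-1\<^esub>(E\<^bsub>2k+2\<^esub>)\<close> bordered by a row and a column. In the basis
  \<open>1, y P\<^sub>0, y P\<^sub>1, \<dots>\<close>, with \<open>P\<^sub>m\<close> orthogonal for \<open>p \<mapsto> L(y p)\<close>, it becomes an arrow matrix, so
  \<open>H\<^sub>n(b\<^sub>k) = - H\<^bsub>n-1\<^esub>(E\<^bsub>2k+2\<^esub>) \<Sum>\<^bsub>m<n\<^esub> L(P\<^sub>m)\<^sup>2 / L(y P\<^sub>m\<^sup>2)\<close>, and the sum is a multiple of \<open>K\<^sub>n\<close>.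
\<close>

subsection \<open>Moment functionals and Hankel determinants\<close>

text \<open>Allows results over fields of characteristic 0 to be applied to rational
  functions.\<close>

instance fract :: ("{idom, ring_char_0}") field_char_0
proof
  have "of_nat n = to_fract (of_nat n :: 'a)" for n
    by (induction n) simp_all
  then show "inj (of_nat :: nat \<Rightarrow> 'a fract)"
    by (intro injI) simp
qed

definition mom :: "(nat \<Rightarrow> 'a :: comm_ring_1) \<Rightarrow> 'a poly \<Rightarrow> 'a" where
  "mom a p = (\<Sum>k\<le>degree p. coeff p k * a k)"

lemma mom_eq_sum:
  assumes "degree p \<le> N"
  shows "mom a p = (\<Sum>k\<le>N. coeff p k * a k)"
  unfolding mom_def using assms
  by (intro sum.mono_neutral_left) (auto simp: coeff_eq_0)

lemma mom_add: "mom a (p + q) = mom a p + mom a q"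
proof -
  define N where "N = max (degree p) (degree q)"
  have "degree (p + q) \<le> N" by (simp add: N_def degree_add_le_max)
  then show ?thesis
    by (simp add: mom_eq_sum[of _ N] N_def sum.distrib algebra_simps)
qed

lemma mom_0 [simp]: "mom a 0 = 0"
  by (simp add: mom_def)

lemma mom_smult: "mom a (smult c p) = c * mom a p"
  using mom_eq_sum[OF degree_smult_le[of c p], of a]
  by (simp add: mom_def[of a p] sum_distrib_left mult.assoc)

lemma mom_diff: "mom a (p - q) = mom a p - mom a q"
  using mom_add[of a p "smult (-1) q"] mom_smult[of a "-1" q] by simp

lemma mom_sum: "mom a (sum f A) = (\<Sum>i\<in>A. mom a (f i))"
  by (induction A rule: infinite_finite_induct) (simp_all add: mom_add)

lemma mom_monom: "mom a (monom c k) = c * a k"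
  by (subst mom_eq_sum[of _ k]) (simp_all add: degree_monom_le if_distrib[of "\<lambda>x. x * _"] cong: if_cong)

lemma mom_pCons: "mom a (pCons c p) = c * a 0 + mom (\<lambda>k. a (Suc k)) p"
proof -
  have "mom a (pCons c p) = (\<Sum>k\<le>Suc (degree p). coeff (pCons c p) k * a k)"
    by (rule mom_eq_sum) (rule degree_pCons_le)
  then show ?thesis
    by (simp add: sum.atMost_Suc_shift mom_def del: sum.atMost_Suc)
qed

text \<open>Substituting \<open>y = s^2\<close> makes the difference equation in \<open>s\<close>
  available for even-indexed moments.\<close>

lemma mom_pcompose_square:
  "mom (\<lambda>k. a (2 * k)) p = mom a (pcompose p [:0, 0, 1:])"
proof (induction p arbitrary: a)
  case (pCons c p)
  show ?case
    using pCons(2)[of "\<lambda>k. a (Suc (Suc k))"] by (simp add: mom_pCons pcompose_pCons mom_add)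
qed simp

lemma mom_mult:
  assumes "degree p \<le> N" "degree q \<le> N"
  shows "mom a (p * q) = (\<Sum>k\<le>N. \<Sum>l\<le>N. coeff p k * a (k + l) * coeff q l)"
proof -
  have "p * q = (\<Sum>k\<le>N. monom (coeff p k) k) * (\<Sum>l\<le>N. monom (coeff q l) l)"
    using assms by (simp add: poly_as_sum_of_monoms')
  also have "\<dots> = (\<Sum>k\<le>N. \<Sum>l\<le>N. monom (coeff p k * coeff q l) (k + l))"
    by (simp add: sum_product mult_monom)
  finally show ?thesis
    by (simp add: mom_sum mom_monom mult_ac)
qed

text \<open>The Gram matrix is \<open>P * (A * Q)\<close> with triangular coefficient matrices
  \<open>P\<close> and \<open>Q\<close>.\<close>

lemma det_gram:
  assumes "\<And>i. degree (p i) \<le> i" "\<And>i. degree (q i) \<le> i"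
  shows "det (mat (Suc n) (Suc n) (\<lambda>(i, j). mom a (p i * q j))) =
    (\<Prod>i\<le>n. coeff (p i) i) * (\<Prod>i\<le>n. coeff (q i) i) * hankel_det n a"
proof -
  define P where "P = mat (Suc n) (Suc n) (\<lambda>(i, k). coeff (p i) k)"
  define Q where "Q = mat (Suc n) (Suc n) (\<lambda>(l, j). coeff (q j) l)"
  define A where "A = mat (Suc n) (Suc n) (\<lambda>(i, j). a (i + j))"
  have carr: "P \<in> carrier_mat (Suc n) (Suc n)" "Q \<in> carrier_mat (Suc n) (Suc n)"
    "A \<in> carrier_mat (Suc n) (Suc n)"
    by (simp_all add: P_def Q_def A_def)
  have "mat (Suc n) (Suc n) (\<lambda>(i, j). mom a (p i * q j)) = P * (A * Q)"
  proof (rule eq_matI)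
    fix i j assume "i < dim_row (P * (A * Q))" "j < dim_col (P * (A * Q))"
    then have ij: "i \<le> n" "j \<le> n" by (simp_all add: P_def Q_def)
    then have "mom a (p i * q j) = (\<Sum>k\<le>n. \<Sum>l\<le>n. coeff (p i) k * a (k + l) * coeff (q j) l)"
      by (intro mom_mult) (use assms[of i] assms[of j] in linarith)+
    then show "mat (Suc n) (Suc n) (\<lambda>(i, j). mom a (p i * q j)) $$ (i, j) = (P * (A * Q)) $$ (i, j)"
      using ij
      by (simp add: P_def A_def Q_def scalar_prod_def sum_distrib_left mult.assoc
          atLeast0LessThan lessThan_Suc_atMost del: sum.op_ivl_Suc sum.lessThan_Suc)
  qed (simp_all add: P_def Q_def)
  moreover have "det P = (\<Prod>i\<le>n. coeff (p i) i)"
    by (subst det_lower_triangular[of "Suc n"])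
      (auto simp: P_def prod_list_diag_prod atLeast0LessThan lessThan_Suc_atMost coeff_eq_0
        le_less_trans[OF assms(1)])
  moreover have "det Q = (\<Prod>i\<le>n. coeff (q i) i)"
    by (subst det_upper_triangular[of _ "Suc n"])
      (auto simp: Q_def prod_list_diag_prod atLeast0LessThan lessThan_Suc_atMost coeff_eq_0
        le_less_trans[OF assms(2)])
  ultimately show ?thesis
    using carr by (simp add: det_mult[of _ "Suc n"] hankel_det_def A_def[symmetric] mult_ac)
qed

text \<open>One-sided orthogonality already makes the Gram matrix triangular, so only one family has
  to consist of orthogonal polynomials.\<close>

lemma hankel_det_LU:
  assumes "\<And>i. degree (p i) \<le> i" "\<And>i. degree (q i) \<le> i"
    and "\<And>i j. i < j \<Longrightarrow> mom a (p i * q j) = 0"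
  shows "(\<Prod>i\<le>n. coeff (p i) i) * (\<Prod>i\<le>n. coeff (q i) i) * hankel_det n a =
    (\<Prod>i\<le>n. mom a (p i * q i))"
  unfolding det_gram[of p q, OF assms(1,2), symmetric]
  by (subst det_lower_triangular[of "Suc n"])
    (auto simp: assms(3) prod_list_diag_prod atLeast0LessThan lessThan_Suc_atMost)

text \<open>Right multiplication by the unipotent \<open>N\<close> clears the first column below the
  corner and leaves the Schur complement in the corner.\<close>

lemma det_arrow:
  fixes u h :: "nat \<Rightarrow> 'a :: field"
  assumes "\<And>i. h i \<noteq> 0"
  shows "det (mat (Suc n) (Suc n) (\<lambda>(i, j).
      if i = 0 then (if j = 0 then 0 else u (j - 1))
      else if j = 0 then u (i - 1) else if i = j then h (i - 1) else 0)) =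
    - (\<Sum>i<n. u i ^ 2 / h i) * (\<Prod>i<n. h i)" (is "det ?M = _")
proof -
  define N where "N = mat (Suc n) (Suc n) (\<lambda>(i, j).
      if i = j then 1 else if j = 0 then - u (i - 1) / h (i - 1) else 0)"
  define T where "T = mat (Suc n) (Suc n) (\<lambda>(i, j).
      if i = 0 then (if j = 0 then - (\<Sum>i<n. u i ^ 2 / h i) else u (j - 1))
      else if i = j then h (i - 1) else 0)"
  have "?M * N = T"
  proof (rule eq_matI)
    fix i j assume "i < dim_row T" "j < dim_col T"
    then have ij: "i < Suc n" "j < Suc n" by (simp_all add: T_def)
    have "(?M * N) $$ (i, j) = (\<Sum>k<Suc n. ?M $$ (i, k) * N $$ (k, j))"
      using ij by (simp add: N_def scalar_prod_def atLeast0LessThan del: sum.lessThan_Suc)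
    also have "\<dots> = ?M $$ (i, 0) * N $$ (0, j) + (\<Sum>k<n. ?M $$ (i, Suc k) * N $$ (Suc k, j))"
      by (rule sum.lessThan_Suc_shift)
    also have "\<dots> = T $$ (i, j)"
    proof (cases j)
      case 0
      show ?thesis
      proof (cases i)
        case 0
        then show ?thesis using \<open>j = 0\<close>
          by (simp add: N_def T_def power2_eq_square sum_negf)
      next
        case (Suc i')
        then have "(\<Sum>k<n. ?M $$ (i, Suc k) * N $$ (Suc k, j)) =
            (\<Sum>k<n. if k = i' then - u i' else 0)"
          using ij \<open>j = 0\<close> assms by (intro sum.cong) (auto simp: N_def)
        then show ?thesis using Suc ij \<open>j = 0\<close> by (simp add: N_def T_def)
      qed
    next
      case (Suc j')
      have "(\<Sum>k<n. ?M $$ (i, Suc k) * N $$ (Suc k, j)) =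
          (\<Sum>k<n. if k = j' then T $$ (i, j) else 0)"
        using ij Suc by (intro sum.cong) (auto simp: N_def T_def)
      then show ?thesis using Suc ij by (simp add: N_def)
    qed
    finally show "(?M * N) $$ (i, j) = T $$ (i, j)" .
  qed (simp_all add: N_def T_def)
  then have "det ?M * det N = det T"
    by (subst det_mult[symmetric, of _ "Suc n"]) (simp_all add: N_def)
  moreover have "det N = 1"
    by (subst det_lower_triangular[of "Suc n"]) (auto simp: N_def prod_list_diag_prod)
  moreover have "det T = - (\<Sum>i<n. u i ^ 2 / h i) * (\<Prod>i<n. h i)"
    by (subst det_upper_triangular[of _ "Suc n"])
      (auto simp: T_def prod_list_diag_prod atLeast0LessThan prod.lessThan_Suc_shift simp del: prod.lessThan_Suc prod.op_ivl_Suc)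
  ultimately show ?thesis by simp
qed

subsection \<open>Functionals of continuous dual Hahn type\<close>

text \<open>At \<open>y = s^2\<close> this is \<open>(-1)^k (a + s)_k (a - s)_k\<close>, the Newton
  basis on which continuous dual Hahn moments are products.\<close>

definition theta :: "'a :: field_char_0 \<Rightarrow> nat \<Rightarrow> 'a poly" where
  "theta a k = (\<Prod>j<k. [:- ((a + of_nat j) ^ 2), 1:])"

lemma theta_0 [simp]: "theta a 0 = 1"
  by (simp add: theta_def)

lemma theta_Suc: "theta a (Suc k) = theta a k * [:- ((a + of_nat k) ^ 2), 1:]"
  by (simp add: theta_def)

text \<open>The node 0 contributes the factor \<open>y\<close>, so shifting the functional moves the
  parameter \<open>a\<close> from 0 to 1.\<close>

lemma theta_0_Suc: "theta 0 (Suc k) = pCons 0 (theta 1 k)"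
  by (induction k) (simp_all add: theta_Suc algebra_simps)

lemma degree_theta: "degree (theta a k) = k"
  by (simp add: theta_def degree_prod_eq_sum_degree)

lemma lead_coeff_theta: "coeff (theta a k) k = 1"
proof -
  have "lead_coeff (theta a k) = 1" by (simp add: theta_def lead_coeff_prod)
  then show ?thesis by (simp add: degree_theta)
qed

text \<open>When \<open>p\<close> is expanded in the basis \<open>theta c\<close>, the second
  assumption kills every term below the top one.\<close>

lemma mom_mult_eq_lead_coeff:
  assumes "degree p \<le> d" and "\<And>i. i < d \<Longrightarrow> mom a (theta c i * q) = 0"
  shows "mom a (p * q) = coeff p d * mom a (theta c d * q)"
  using assms
proof (induction d arbitrary: p)
  case 0
  then obtain r where "p = [:r:]" by (auto elim: degree_eq_zeroE)
  then show ?case by (simp add: mom_smult)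
next
  case (Suc d)
  define r where "r = p - smult (coeff p (Suc d)) (theta c (Suc d))"
  have "degree r \<le> Suc d"
    unfolding r_def
    by (intro degree_diff_le order_trans[OF degree_smult_le])
      (use Suc.prems in \<open>simp_all add: degree_theta\<close>)
  moreover have "coeff r (Suc d) = 0" by (simp add: r_def lead_coeff_theta)
  ultimately have "degree r \<le> d"
    by (metis degree_le coeff_eq_0 le_neq_implies_less less_Suc_eq_le linorder_not_le order_le_less)
  then have "mom a (r * q) = coeff r d * mom a (theta c d * q)"
    by (intro Suc.IH) (simp_all add: Suc.prems)
  then have "mom a (r * q) = 0" by (simp add: Suc.prems)
  moreover have "p * q = r * q + smult (coeff p (Suc d)) (theta c (Suc d) * q)"
    by (simp add: r_def algebra_simps)
  ultimately show ?case by (simp add: mom_add mom_smult)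
qed

text \<open>
  For \<open>b + c = 1\<close>, \<open>diffQ a b m 0\<close> is up to normalisation the continuous dual Hahn polynomial of
  degree \<open>m\<close> with parameters \<open>a, b, c\<close>. Its hypergeometric sum is written as an \<open>m\<close>-th difference, so
  that moments against it are \<open>m\<close>-th differences of rising factorials.
\<close>

primrec diffQ :: "'a :: field_char_0 \<Rightarrow> 'a \<Rightarrow> nat \<Rightarrow> nat \<Rightarrow> 'a poly" where
  "diffQ a b 0 = (\<lambda>j. smult (1 / ((-1) ^ j * fact j * pochhammer (a + b) j)) (theta b j))"
| "diffQ a b (Suc m) = (\<lambda>j. diffQ a b m (Suc j) - diffQ a b m j)"

lemma degree_diffQ: "degree (diffQ a b m j) \<le> m + j"
proof (induction m arbitrary: j)
  case 0
  show ?case using degree_smult_le[of _ "theta b j"] by (simp add: degree_theta)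
next
  case (Suc m)
  show ?case
    using Suc[of "Suc j"] Suc[of j] by (auto intro!: degree_diff_le)
qed

lemma coeff_diffQ:
  "coeff (diffQ a b m j) (m + j) = 1 / ((-1) ^ (m + j) * fact (m + j) * pochhammer (a + b) (m + j))"
proof (induction m arbitrary: j)
  case 0
  show ?case by (simp add: lead_coeff_theta)
next
  case (Suc m)
  have "coeff (diffQ a b m j) (Suc (m + j)) = 0"
    by (rule coeff_eq_0) (use degree_diffQ[of a b m j] in linarith)
  then show ?case using Suc[of "Suc j"] by simp
qed

text \<open>Moments of continuous dual Hahn type with parameters \<open>a, b, c\<close> and total
  mass \<open>w\<close>; \<open>nonzero\<close> keeps the denominators in \<open>diffQ\<close> from
  vanishing.\<close>

locale dual_hahn_moments =
  fixes \<mu> :: "nat \<Rightarrow> 'a :: field_char_0" and w a b c :: 'a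
  assumes sum_eq_1: "b + c = 1"
    and moment: "\<And>k. mom \<mu> (theta a k) = w * (-1) ^ k * pochhammer (a + b) k * pochhammer (a + c) k"
    and nonzero: "\<And>k. pochhammer (a + b) k \<noteq> 0"
begin

text \<open>Since \<open>y - (b+j)^2 = (y - (a+i)^2) + ((a+i)^2 - (b+j)^2)\<close>, the last factor
  of \<open>theta b\<close> can be traded for one of \<open>theta a\<close>. The factor
  \<open>fact j\<close> is \<open>(b + c)_j\<close>.\<close>

lemma mom_theta_theta:
  "mom \<mu> (theta a i * theta b j) =
    w * (-1) ^ (i + j) * pochhammer (a + c) i * fact j * pochhammer (a + b) (i + j)"
proof (induction j arbitrary: i)
  case 0
  show ?case by (simp add: moment)
next
  case (Suc j)
  let ?d = "(a + of_nat i) ^ 2 - (b + of_nat j) ^ 2"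
  have c: "c = 1 - b" using sum_eq_1 by (simp add: algebra_simps)
  have "theta a i * theta b (Suc j) =
      theta a (Suc i) * theta b j + smult ?d (theta a i * theta b j)"
    by (simp add: theta_Suc smult_diff_left algebra_simps)
  then have "mom \<mu> (theta a i * theta b (Suc j)) =
      mom \<mu> (theta a (Suc i) * theta b j) + ?d * mom \<mu> (theta a i * theta b j)"
    by (simp add: mom_add mom_smult)
  also have "\<dots> = w * (-1) ^ (i + j) * pochhammer (a + c) i * fact j * pochhammer (a + b) (i + j) *
      (?d - (a + c + of_nat i) * (a + b + of_nat (i + j)))"
    unfolding Suc by (simp add: pochhammer_Suc algebra_simps)
  also have "?d - (a + c + of_nat i) * (a + b + of_nat (i + j)) =
      - (of_nat (Suc j) * (a + b + of_nat (i + j)))"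
    unfolding c by (simp add: algebra_simps power2_eq_square)
  finally show ?case by (simp add: pochhammer_Suc mult_ac)
qed

text \<open>The normalisation of \<open>diffQ\<close> turns the moments at \<open>m = 0\<close> into
  multiples of \<open>(a + b + j)_i\<close>, of degree \<open>i\<close> in \<open>j\<close>. Each
  difference in \<open>j\<close> lowers the degree, so they vanish for \<open>i < m\<close>.\<close>

lemma mom_theta_diffQ:
  "mom \<mu> (theta a i * diffQ a b m j) =
    w * (-1) ^ i * pochhammer (a + c) i * fact m * of_nat (i choose m) *
      pochhammer (a + b + of_nat (j + m)) (i - m)"
proof (induction m arbitrary: j)
  case 0
  have "pochhammer (a + b) (i + j) = pochhammer (a + b) j * pochhammer (a + b + of_nat j) i"
    by (subst add.commute) (rule pochhammer_product')
  then show ?case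
    using nonzero[of j] by (simp add: mom_smult mom_theta_theta power_add)
next
  case (Suc m)
  define z where "z = a + b + of_nat (j + m)"
  have "mom \<mu> (theta a i * diffQ a b (Suc m) j) =
      w * (-1) ^ i * pochhammer (a + c) i * fact m * of_nat (i choose m) *
        (pochhammer (z + 1) (i - m) - pochhammer z (i - m))"
    using Suc[of "Suc j"] Suc[of j]
    by (simp add: mom_diff right_diff_distrib z_def add_ac)
  also have "pochhammer (z + 1) (i - m) - pochhammer z (i - m) =
      of_nat (i - m) * pochhammer (z + 1) (i - Suc m)"
  proof (cases "i - m")
    case (Suc k)
    then have "i - Suc m = k" by simp
    have "pochhammer (z + 1) (Suc k) - pochhammer z (Suc k) =
        of_nat (Suc k) * pochhammer (z + 1) k"
      by (simp add: pochhammer_rec[of z] pochhammer_Suc[of "1 + z"] algebra_simps)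
    then show ?thesis using Suc \<open>i - Suc m = k\<close> by simp
  qed simp
  also have "w * (-1) ^ i * pochhammer (a + c) i * fact m * of_nat (i choose m) *
        (of_nat (i - m) * pochhammer (z + 1) (i - Suc m)) =
      w * (-1) ^ i * pochhammer (a + c) i * (fact m * of_nat ((i - m) * (i choose m))) *
        pochhammer (z + 1) (i - Suc m)"
    by (simp add: mult_ac)
  also have "(i - m) * (i choose m) = Suc m * (i choose Suc m)"
    by (metis binomial_absorb_comp binomial_absorption)
  finally show ?case by (simp add: z_def algebra_simps)
qed

lemma mom_theta_diffQ_eq_0: "i < m \<Longrightarrow> mom \<mu> (theta a i * diffQ a b m j) = 0"
  by (simp add: mom_theta_diffQ)

lemma mom_theta_diffQ_same:
  "mom \<mu> (theta a m * diffQ a b m 0) = w * (-1) ^ m * pochhammer (a + c) m * fact m"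
  by (simp add: mom_theta_diffQ)

lemma mom_diffQ_diffQ:
  "mom \<mu> (diffQ a b i 0 * diffQ a b j 0) =
    (if i = j then w * pochhammer (a + c) i / pochhammer (a + b) i else 0)"
proof -
  have *: "mom \<mu> (diffQ a b i 0 * diffQ a b j 0) = 0" if "i < j" for i j
    using mom_mult_eq_lead_coeff[of "diffQ a b i 0" i \<mu> a "diffQ a b j 0"] that
      degree_diffQ[of a b i 0] by (simp add: mom_theta_diffQ_eq_0)
  have "mom \<mu> (diffQ a b i 0 * diffQ a b i 0) = w * pochhammer (a + c) i / pochhammer (a + b) i"
    using mom_mult_eq_lead_coeff[of "diffQ a b i 0" i \<mu> a "diffQ a b i 0"]
      degree_diffQ[of a b i 0] coeff_diffQ[of a b i 0]
    by (simp add: mom_theta_diffQ_eq_0 mom_theta_diffQ_same)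
  then show ?thesis
    using *[of i j] *[of j i] by (cases i j rule: linorder_cases) (simp_all add: mult.commute)
qed

text \<open>Triangular evaluation with the monic \<open>theta a\<close> for rows and the orthogonal
  \<open>diffQ\<close> for columns; the leading coefficients of \<open>diffQ\<close> cancel.\<close>

lemma hankel_det_eq_prod:
  "hankel_det n \<mu> = (\<Prod>m\<le>n. w * pochhammer (a + b) m * pochhammer (a + c) m * fact m ^ 2)"
proof -
  let ?l = "\<lambda>m. coeff (diffQ a b m 0) m"
  have l: "?l m = 1 / ((-1) ^ m * fact m * pochhammer (a + b) m)" for m
    using coeff_diffQ[of a b m 0] by simp
  have nz: "?l m \<noteq> 0" for m using nonzero[of m] by (simp add: l)
  have "(\<Prod>m\<le>n. ?l m) * hankel_det n \<mu> = (\<Prod>m\<le>n. mom \<mu> (theta a m * diffQ a b m 0))"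
    using hankel_det_LU[of "theta a" "\<lambda>m. diffQ a b m 0" \<mu> n] degree_diffQ[of a b _ 0]
    by (simp add: degree_theta lead_coeff_theta mom_theta_diffQ_eq_0)
  also have "\<dots> = (\<Prod>m\<le>n. ?l m *
      (w * pochhammer (a + b) m * pochhammer (a + c) m * fact m ^ 2))"
    using nonzero by (intro prod.cong) (simp_all add: mom_theta_diffQ_same l power2_eq_square field_simps)
  finally show ?thesis using nz by (simp add: prod.distrib)
qed

end

subsection \<open>The Euler functional\<close>

text \<open>Umbral form of \<open>E_n(b + 1) + E_n(b) = 2 b^n\<close>, extended from monomials by
  linearity.\<close>

lemma mom_shift:
  fixes b :: "'a :: field_char_0"
  assumes "\<And>n. (\<Sum>k\<le>n. of_nat (n choose k) * e k) + e n = 2 * b ^ n"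
  shows "mom e (pcompose p [:1, 1:]) + mom e p = 2 * poly p b"
proof -
  have *: "mom e (pcompose (monom r n) [:1, 1:]) + mom e (monom r n) = 2 * poly (monom r n) b" for r n
  proof -
    have "pcompose (monom r n) [:1, 1:] = smult r ([:1, 1:] ^ n)"
      by (induction n) (simp_all add: monom_0 monom_Suc pcompose_pCons mult_smult_right)
    moreover have "mom e ([:1, 1:] ^ n) = (\<Sum>k\<le>n. of_nat (n choose k) * e k)"
      using mom_eq_sum[of "[:1, 1:] ^ n" n e]
      by (simp add: degree_linear_power coeff_linear_poly_power)
    ultimately show ?thesis
      using assms[of n] by (simp add: mom_smult mom_monom poly_monom flip: distrib_left)
  qed
  have "p = (\<Sum>k\<le>degree p. monom (coeff p k) k)" by (simp add: poly_as_sum_of_monoms)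
  then obtain f d where p: "p = (\<Sum>k\<le>d. monom (f k) k)" by blast
  show ?thesis
    by (simp add: p pcompose_sum mom_sum poly_sum sum_distrib_left * flip: sum.distrib)
qed

text \<open>The difference equation reduces the moment to the value
  \<open>poly (\<omega> k) b\<close>, whose factors \<open>(b + j) (b - 1 - j)\<close> form two
  rising factorials up to sign.\<close>

lemma mom_even_theta_0:
  fixes b :: "'a :: field_char_0"
  assumes "\<And>n. (\<Sum>k\<le>n. of_nat (n choose k) * e k) + e n = 2 * b ^ n"
  shows "mom (\<lambda>k. e (2 * k)) (theta 0 k) = (-1) ^ k * pochhammer b k * pochhammer (1 - b) k"
proof -
  define \<omega> where "\<omega> k = (\<Prod>j<k. [:of_nat j, 1:] * [:- of_nat j - 1, 1:] :: 'a poly)" for k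
  define \<tau> where "\<tau> k = pcompose (theta (0 :: 'a) k) [:0, 0, 1:]" for k
  have \<omega>_0: "\<omega> 0 = 1" and \<omega>_Suc: "\<omega> (Suc k) = \<omega> k * ([:of_nat k, 1:] * [:- of_nat k - 1, 1:])" for k
    by (simp_all add: \<omega>_def)
  have \<tau>_0: "\<tau> 0 = 1" and \<tau>_Suc: "\<tau> (Suc k) = \<tau> k * ([:of_nat k, 1:] * [:- of_nat k, 1:])" for k
    unfolding \<tau>_def theta_Suc pcompose_mult
    by (simp_all add: pcompose_pCons pcompose_1 power2_eq_square)
  \<comment> \<open>With \<open>s = [:0, 1:]\<close>, \<open>\<omega> k\<close> is chosen so that \<open>\<omega>(s + 1) + \<omega>(s) = 2 \<tau>(s)\<close>, which allows the use of
     the difference equation; both summands are compared after multiplication by \<open>s\<close>.\<close>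
  have l: "[:0, 1:] * \<omega> k = \<tau> k * [:- of_nat k, 1:]" for k
  proof (induction k)
    case (Suc k)
    have "[:0, 1:] * \<omega> (Suc k) = ([:0, 1:] * \<omega> k) * ([:of_nat k, 1:] * [:- of_nat k - 1, 1:])"
      by (simp only: \<omega>_Suc mult.assoc)
    also have "\<dots> = \<tau> (Suc k) * [:- of_nat (Suc k), 1:]"
      unfolding Suc \<tau>_Suc
      by (simp only: mult_ac of_nat_Suc minus_add_distrib)
        (simp only: mult_ac diff_conv_add_uminus add.commute)
    finally show ?case .
  qed (simp add: \<omega>_0 \<tau>_0)
  have r: "[:0, 1:] * pcompose (\<omega> k) [:1, 1:] = \<tau> k * [:of_nat k, 1:]" for k
  proof (induction k)
    case (Suc k)
    have "pcompose (\<omega> (Suc k)) [:1, 1:] =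
        pcompose (\<omega> k) [:1, 1:] * ([:of_nat (Suc k), 1:] * [:- of_nat k, 1:])"
      by (simp only: \<omega>_Suc pcompose_mult) (simp add: pcompose_pCons algebra_simps)
    then have "[:0, 1:] * pcompose (\<omega> (Suc k)) [:1, 1:] =
        ([:0, 1:] * pcompose (\<omega> k) [:1, 1:]) * ([:of_nat (Suc k), 1:] * [:- of_nat k, 1:])"
      by (simp only: mult.assoc)
    also have "\<dots> = \<tau> (Suc k) * [:of_nat (Suc k), 1:]"
      unfolding Suc \<tau>_Suc by (simp only: mult_ac)
    finally show ?case .
  qed (simp add: \<omega>_0 \<tau>_0 pcompose_1)
  \<comment> \<open>The linear factors \<open>s + k\<close> and \<open>s - k\<close> from
    \<open>r\<close> and \<open>l\<close> add up to \<open>2 s\<close>, and \<open>s\<close>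
    cancels.\<close>
  have "[:0, 1:] * (pcompose (\<omega> k) [:1, 1:] + \<omega> k) = [:0, 1:] * smult 2 (\<tau> k)"
    unfolding distrib_left l r by (simp add: numeral_poly flip: distrib_left)
  then have "pcompose (\<omega> k) [:1, 1:] + \<omega> k = smult 2 (\<tau> k)"
    by (subst (asm) mult_left_cancel) auto
  then have "2 * mom e (\<tau> k) = 2 * poly (\<omega> k) b"
    using mom_shift[OF assms, of "\<omega> k"] by (simp add: mom_smult flip: mom_add)
  moreover have "poly (\<omega> k) b = (-1) ^ k * pochhammer b k * pochhammer (1 - b) k"
    by (induction k) (simp_all add: \<omega>_0 \<omega>_Suc pochhammer_Suc algebra_simps)
  ultimately show ?thesis
    by (simp add: mom_pcompose_square \<tau>_def)
qed

section \<open>Evaluation of the bordered Hankel determinant\<close>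

lemma hankel_det_shifted_even:
  fixes b c :: "'a :: field_char_0"
  assumes e: "\<And>n. (\<Sum>k\<le>n. of_nat (n choose k) * e k) + e n = 2 * b ^ n"
    and bc: "b + c = 1"
    and nz: "\<And>k. pochhammer b k \<noteq> 0" "\<And>k. pochhammer c k \<noteq> 0"
  shows "hankel_det n (\<lambda>k. if k = 0 then 0 else e (2 * k - 2)) =
    (-1) ^ n / (fact n ^ 2 * (b * c)) *
    (\<Sum>m<n. fact m ^ 2 / (pochhammer (1 + b) m * pochhammer (1 + c) m)) *
    hankel_det n (\<lambda>k. e (2 * k))"
proof -
  define \<mu> where "\<mu> k = e (2 * k)" for k
  define \<beta> where "\<beta> k = (if k = 0 then 0 else e (2 * k - 2))" for k
  have c: "c = 1 - b" using bc by (simp add: algebra_simps)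
  have [simp]: "b \<noteq> 0" "c \<noteq> 0" using nz[of 1] by simp_all
  have rec: "b * pochhammer (1 + b) k = pochhammer b (Suc k)"
    "c * pochhammer (1 + c) k = pochhammer c (Suc k)" for k
    by (simp_all add: pochhammer_rec add.commute)
  have nz1 [simp]: "pochhammer (1 + b) k \<noteq> 0" "pochhammer (1 + c) k \<noteq> 0" for k
    using rec[of k] nz[of "Suc k"] by auto
  interpret C: dual_hahn_moments \<mu> 1 0 b c
    using mom_even_theta_0[OF e] nz bc by unfold_locales (simp_all add: \<mu>_def[abs_def] c)
  \<comment> \<open>Removing the node 0 raises \<open>a\<close> from 0 to 1; the mass is
    \<open>L(y) = - b c\<close>.\<close>
  interpret D: dual_hahn_moments "\<lambda>k. \<mu> (Suc k)" "- (b * c)" 1 b c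
  proof
    fix k
    have "mom (\<lambda>k. \<mu> (Suc k)) (theta 1 k) = mom \<mu> (theta 0 (Suc k))"
      by (simp add: theta_0_Suc mom_pCons)
    also have "\<dots> = - (b * c) * (-1) ^ k * pochhammer (1 + b) k * pochhammer (1 + c) k"
      using rec[of k] by (simp add: C.moment mult_ac flip: rec)
    finally show "mom (\<lambda>k. \<mu> (Suc k)) (theta 1 k) =
      - (b * c) * (-1) ^ k * pochhammer (1 + b) k * pochhammer (1 + c) k" .
  qed (simp_all add: bc)
  have nz2: "pochhammer (b + of_nat j) k \<noteq> 0" for j k
    using pochhammer_product'[of b j k] nz(1)[of "j + k"] by auto
  \<comment> \<open>For \<open>m = 0\<close> the value is
    \<open>(b)_j / (1 + b)_j = b / (b + j)\<close>; the \<open>m\<close>-th difference of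
    \<open>1 / (b + j)\<close> in \<open>j\<close> is
    \<open>(-1)^m m! / (b + j)_(m+1)\<close>.\<close>
  have mom_diffQ: "mom \<mu> (diffQ 1 b m j) =
      (-1) ^ m * fact m * b / pochhammer (b + of_nat j) (Suc m)" for m j
  proof (induction m arbitrary: j)
    case 0
    have "b * pochhammer (1 + b) j = pochhammer b j * (b + of_nat j)"
      by (simp add: rec pochhammer_Suc)
    moreover have "b + of_nat j \<noteq> 0" using nz2[of j 1] by simp
    ultimately show ?case
      using C.mom_theta_theta[of 0 j] by (simp add: mom_smult field_simps)
  next
    case (Suc m)
    define z where "z = b + of_nat j"
    have "pochhammer z (Suc (Suc m)) = z * pochhammer (z + 1) (Suc m)"
      "pochhammer z (Suc (Suc m)) = (z + of_nat (Suc m)) * pochhammer z (Suc m)"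
      by (rule pochhammer_rec, rule pochhammer_rec')
    moreover have "pochhammer z k \<noteq> 0" for k using nz2[of j k] by (simp add: z_def)
    ultimately have inv: "1 / pochhammer (z + 1) (Suc m) = z / pochhammer z (Suc (Suc m))"
      "1 / pochhammer z (Suc m) = (z + of_nat (Suc m)) / pochhammer z (Suc (Suc m))"
      by (metis divide_eq_eq_1 mult_divide_mult_cancel_left_if mult.right_neutral mult_eq_0_iff)+
    have "mom \<mu> (diffQ 1 b (Suc m) j) = (-1) ^ m * fact m * b *
        (1 / pochhammer (z + 1) (Suc m) - 1 / pochhammer z (Suc m))"
      using Suc[of "Suc j"] Suc[of j] by (simp add: mom_diff z_def right_diff_distrib add_ac)
    also have "\<dots> = (-1) ^ Suc m * fact (Suc m) * b / pochhammer z (Suc (Suc m))"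
      unfolding inv by (simp add: algebra_simps flip: diff_divide_distrib del: pochhammer_Suc)
    finally show ?case by (simp add: z_def)
  qed
  \<comment> \<open>\<open>q\<close> is orthogonal for the functional of \<open>D\<close>, with
    norms \<open>h\<close> and leading coefficients \<open>l\<close>; \<open>u\<close> will be the
    border of the arrow matrix.\<close>
  define q where "q m = diffQ 1 b m 0" for m
  define u where "u m = mom \<mu> (q m)" for m
  define h where "h m = - (b * c) * pochhammer (1 + c) m / pochhammer (1 + b) m" for m
  define l where "l m = coeff (q m) m" for m
  define p where "p i = (case i of 0 \<Rightarrow> 1 | Suc m \<Rightarrow> pCons 0 (q m))" for i
  have l: "l m = 1 / ((-1) ^ m * fact m * pochhammer (1 + b) m)" for m
    using coeff_diffQ[of 1 b m 0] by (simp add: l_def q_def)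
  have l_nz: "l m \<noteq> 0" for m by (simp add: l)
  have h_nz: "h m \<noteq> 0" for m by (simp add: h_def)
  have deg: "degree (p i) \<le> i" for i
    using degree_diffQ[of 1 b "i - 1" 0] degree_pCons_le[of 0 "q (i - 1)"]
    by (cases i) (simp_all add: p_def q_def)
  \<comment> \<open>As \<open>\<beta> 0 = 0\<close>, the functional of \<open>\<beta>\<close> drops
    the constant term and divides the rest by \<open>y\<close>. A product of two multiples of
    \<open>y\<close> keeps one \<open>y\<close>, which gives the functional of
    \<open>D\<close>.\<close>
  have \<beta>: "mom \<beta> (pCons r s) = mom \<mu> s" for r s
    by (simp add: mom_pCons \<beta>_def \<mu>_def[abs_def])
  have \<beta>_1: "mom \<beta> 1 = 0"
    using \<beta>[of 1 0] by (simp add: one_pCons)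
  have \<mu>: "mom \<mu> (pCons 0 s) = mom (\<lambda>k. \<mu> (Suc k)) s" for s
    by (simp add: mom_pCons)
  have gram: "mom \<beta> (p i * p j) =
      (if i = 0 then (if j = 0 then 0 else u (j - 1))
      else if j = 0 then u (i - 1) else if i = j then h (i - 1) else 0)" for i j
    using D.mom_diffQ_diffQ[of "i - 1" "j - 1"]
    by (cases i; cases j) (auto simp: p_def \<beta> \<beta>_1 \<mu> u_def h_def q_def)
  have \<Pi>p: "(\<Prod>i\<le>n. coeff (p i) i) = (\<Prod>m<n. l m)"
    by (simp add: prod.lessThan_Suc_shift p_def l_def flip: lessThan_Suc_atMost del: prod.lessThan_Suc)
  have u: "u m = (-1) ^ m * fact m / pochhammer (1 + b) m" for m
    using mom_diffQ[of m 0] by (simp add: u_def q_def flip: rec)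
  have "(\<Prod>m<n. l m) ^ 2 * hankel_det n \<beta> = - (\<Sum>m<n. u m ^ 2 / h m) * (\<Prod>m<n. h m)"
    using det_gram[of p p n \<beta>] deg det_arrow[of h n u] h_nz
    by (simp add: gram \<Pi>p power2_eq_square cong: if_cong)
  also have "(\<Sum>m<n. u m ^ 2 / h m) = - (1 / (b * c)) *
      (\<Sum>m<n. fact m ^ 2 / (pochhammer (1 + b) m * pochhammer (1 + c) m))" (is "_ = _ * ?S")
    unfolding sum_distrib_left
    by (intro sum.cong) (simp_all add: u h_def power2_eq_square field_simps)
  \<comment> \<open>Splitting off \<open>l m ^ 2\<close> lets the normalisation cancel; for
    \<open>n \<ge> 1\<close> the remaining product is \<open>hankel_det (n - 1)\<close> of the
    shifted moments.\<close>
  also have "(\<Prod>m<n. h m) = (\<Prod>m<n. l m ^ 2 *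
      (- (pochhammer b (Suc m) * pochhammer c (Suc m) * fact m ^ 2)))"
    by (intro prod.cong) (simp_all add: h_def l power2_eq_square field_simps flip: rec)
  also have "\<dots> = (\<Prod>m<n. l m) ^ 2 *
      (\<Prod>m<n. - (pochhammer b (Suc m) * pochhammer c (Suc m) * fact m ^ 2))"
    by (simp only: prod.distrib prod_power_distrib)
  finally have "(\<Prod>m<n. l m) ^ 2 * hankel_det n \<beta> = (\<Prod>m<n. l m) ^ 2 * ((1 / (b * c)) * ?S *
      (\<Prod>m<n. - (pochhammer b (Suc m) * pochhammer c (Suc m) * fact m ^ 2)))"
    by (simp add: mult_ac)
  moreover have "(\<Prod>m<n. l m) ^ 2 \<noteq> 0" using l_nz by simp
  ultimately have B: "hankel_det n \<beta> = (1 / (b * c)) * ?S *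
      (\<Prod>m<n. - (pochhammer b (Suc m) * pochhammer c (Suc m) * fact m ^ 2))"
    by (subst (asm) mult_left_cancel)
  \<comment> \<open>The factor \<open>m = 0\<close> is 1, so the indices move up by one; comparing
    \<open>fact (Suc m)\<close> with \<open>fact m\<close> then produces
    \<open>fact n ^ 2\<close>.\<close>
  have "hankel_det n \<mu> = (\<Prod>m<n. pochhammer b (Suc m) * pochhammer c (Suc m) * fact (Suc m) ^ 2)"
    unfolding C.hankel_det_eq_prod
    by (simp add: prod.lessThan_Suc_shift flip: lessThan_Suc_atMost del: prod.lessThan_Suc fact_Suc)
  also have "\<dots> = (-1) ^ n * fact n ^ 2 *
      (\<Prod>m<n. - (pochhammer b (Suc m) * pochhammer c (Suc m) * fact m ^ 2))"
    by (induction n) (simp_all add: power2_eq_square algebra_simps)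
  finally have "(\<Prod>m<n. - (pochhammer b (Suc m) * pochhammer c (Suc m) * fact m ^ 2)) =
      (-1) ^ n / fact n ^ 2 * hankel_det n \<mu>"
    by (simp add: power_mult_distrib[symmetric] flip: mult.assoc)
  then have "hankel_det n \<beta> = (-1) ^ n / (fact n ^ 2 * (b * c)) * ?S * hankel_det n \<mu>"
    using B by (simp add: mult_ac)
  then show ?thesis by (simp add: \<beta>_def[abs_def] \<mu>_def[abs_def])
qed

section \<open>The recurrence of the Euler polynomials\<close>

lemma euler_poly_recurrence:
  "(\<Sum>k\<le>n. of_nat (n choose k) * euler_poly k) + euler_poly n =
    2 * (monom 1 n :: 'a :: field_char_0 poly)"
proof -
  define g :: "'a fps" where "g = 2 / (fps_exp 1 + 1)"
  define M :: "'a poly fps" where "M = Abs_fps (\<lambda>n. monom (1 / fact n) n)"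
  \<comment> \<open>\<open>L\<close> embeds scalar series coefficientwise as a ring homomorphism, so
    \<open>(e^t + 1) g = 2\<close> carries over to series with polynomial coefficients.\<close>
  define L :: "'a fps \<Rightarrow> 'a poly fps" where "L f = Abs_fps (\<lambda>n. [:fps_nth f n:])" for f
  have const_sum: "[:sum f A:] = (\<Sum>i\<in>A. [:f i:])" for f :: "nat \<Rightarrow> 'a" and A
    by (rule poly_eqI) (simp add: coeff_sum coeff_pCons split: nat.split)
  have smult_sum_right: "smult r (sum f A) = (\<Sum>i\<in>A. smult r (f i))" for r and f :: "nat \<Rightarrow> 'a poly" and A
    by (induction A rule: infinite_finite_induct) (simp_all add: smult_add_right)
  have "(fps_exp 1 + 1) * g = 2"
    unfolding g_def by (subst mult.commute, rule fps_times_divide_eq) (auto simp: fps_eq_iff intro!: exI[of _ 0])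
  moreover have "L (f * h) = L f * L h" for f h
    by (simp add: L_def fps_eq_iff fps_mult_nth const_sum mult.commute)
  moreover have "L (f + h) = L f + L h" for f h
    by (simp add: L_def fps_eq_iff)
  moreover have "L 1 = 1" "L 2 = 2"
    by (simp_all add: L_def fps_eq_iff one_pCons numeral_poly fps_numeral_nth)
  ultimately have "(L (fps_exp 1) + 1) * L g = 2" by metis
  moreover have "euler_gf = L g * M"
    by (simp add: euler_gf_def L_def M_def g_def)
  then have "L (fps_exp 1) * euler_gf + euler_gf = (L (fps_exp 1) + 1) * L g * M"
    by (simp add: distrib_right mult.assoc)
  ultimately have "L (fps_exp 1) * euler_gf + euler_gf = M + M" by simp
  then have "fps_nth (euler_gf * L (fps_exp 1)) n + fps_nth euler_gf n = 2 * fps_nth M n"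
    by (simp only: mult.commute[of euler_gf] mult_2 flip: fps_add_nth)
  then have "(\<Sum>k\<le>n. smult (1 / fact (n - k)) (fps_nth euler_gf k)) + fps_nth euler_gf n =
      2 * (monom (1 / fact n) n :: 'a poly)"
    by (simp add: fps_mult_nth L_def M_def atLeast0AtMost mult_ac)
  then have "smult (fact n) ((\<Sum>k\<le>n. smult (1 / fact (n - k)) (fps_nth euler_gf k)) +
      fps_nth euler_gf n) = smult (fact n) (2 * (monom (1 / fact n) n :: 'a poly))"
    by simp
  moreover have "smult (fact n) (\<Sum>k\<le>n. smult (1 / fact (n - k)) (fps_nth euler_gf k)) =
      (\<Sum>k\<le>n. of_nat (n choose k) * euler_poly k :: 'a poly)"
    unfolding smult_sum_right
    by (intro sum.cong) (simp_all add: euler_poly_def of_nat_poly binomial_fact)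
  moreover have "smult (fact n) (2 * monom (1 / fact n) n) = 2 * (monom 1 n :: 'a poly)"
    by (simp add: smult_monom flip: mult_smult_right)
  ultimately show ?thesis
    by (simp add: smult_add_right euler_poly_def)
qed

section \<open>Passage to rational functions and conclusion\<close>

lemma to_fract_of_nat [simp]: "to_fract (of_nat n) = of_nat n"
  by (induction n) simp_all

lemma to_fract_power [simp]: "to_fract (p ^ n) = to_fract p ^ n"
  by (induction n) simp_all

lemma to_fract_euler_poly_half_recurrence:
  "(\<Sum>k\<le>n. of_nat (n choose k) * to_fract (euler_poly_half k :: 'a :: field_char_0 poly)) +
    to_fract (euler_poly_half n) = 2 * ((1 + ratfun_X) / 2) ^ n"
proof -
  let ?h = "[:1 / 2, 1 / 2:] :: 'a poly"
  have "pcompose (of_nat m) ?h = of_nat m" for m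
    by (simp add: of_nat_poly)
  moreover have "pcompose (monom 1 n) ?h = ?h ^ n"
    by (induction n) (simp_all add: monom_0 monom_Suc pcompose_pCons one_pCons)
  moreover have "pcompose 2 ?h = 2" by (simp add: numeral_poly)
  ultimately have "(\<Sum>k\<le>n. of_nat (n choose k) * euler_poly_half k) + euler_poly_half n = 2 * ?h ^ n"
    using arg_cong[OF euler_poly_recurrence[of n], of "\<lambda>p. pcompose p ?h"]
    by (simp add: pcompose_add pcompose_sum pcompose_mult euler_poly_half_def)
  from arg_cong[OF this, of to_fract]
  have "(\<Sum>k\<le>n. of_nat (n choose k) * to_fract (euler_poly_half k :: 'a poly)) +
      to_fract (euler_poly_half n) = to_fract 2 * to_fract ?h ^ n"
    by (simp del: to_fract_eq_iff)
  moreover have two: "to_fract (2 :: 'a poly) = 2"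
    using to_fract_of_nat[of 2, where 'a = "'a poly"] by simp
  moreover have "to_fract ?h = (1 + ratfun_X) / 2"
  proof -
    have "2 * ?h = 1 + [:0, 1:]" by (simp add: numeral_poly one_pCons)
    then have "to_fract 2 * to_fract ?h = to_fract 1 + to_fract [:0, 1:]"
      by (simp only: flip: to_fract_mult to_fract_add)
    then show ?thesis by (simp add: two ratfun_X_def field_simps)
  qed
  ultimately show ?thesis by simp
qed

lemma to_fract_hankel_det: "to_fract (hankel_det n a) = hankel_det n (\<lambda>k. to_fract (a k))"
proof -
  interpret comm_ring_hom "to_fract :: 'a \<Rightarrow> 'a fract"
    by unfold_locales simp_all
  show ?thesis
    unfolding hankel_det_def hom_det[symmetric]
    by (intro arg_cong[of _ _ det]) auto
qed

text \<open>With \<open>b = (1 + x)/2\<close> and \<open>c = (1 - x)/2\<close> one has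
  \<open>(2 i + 1)^2 - x^2 = 4 (b + i) (c + i)\<close>, so this is a partial sum of the series
  \<open>3F2(1, 1, 1; 1 + b, 1 + c; 1)\<close>. The initial 1 is the term \<open>m = 0\<close>,
  present as \<open>n \<ge> 1\<close>.\<close>

lemma K_fun_eq_sum:
  fixes x :: "'a :: field_char_0"
  assumes "n \<ge> 1"
  shows "K_fun n x =
    (\<Sum>m<n. fact m ^ 2 / (pochhammer (1 + (1 + x) / 2) m * pochhammer (1 + (1 - x) / 2) m))"
proof -
  let ?f = "\<lambda>m. fact m ^ 2 / (pochhammer (1 + (1 + x) / 2) m * pochhammer (1 + (1 - x) / 2) m)"
  have f: "(\<Prod>i = 1..m. of_nat (2 * i) ^ 2 / (of_nat (2 * i + 1) ^ 2 - x ^ 2)) = ?f m" for m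
  proof (induction m)
    case (Suc m)
    have "of_nat (2 * Suc m + 1) ^ 2 - x ^ 2 =
        4 * ((1 + (1 + x) / 2 + of_nat m) * (1 + (1 - x) / 2 + of_nat m))"
      by (simp add: field_simps power2_eq_square)
    moreover have "of_nat (2 * Suc m) ^ 2 = 4 * (of_nat (Suc m) :: 'a) ^ 2"
      by (simp add: field_simps power2_eq_square)
    ultimately have "of_nat (2 * Suc m) ^ 2 / (of_nat (2 * Suc m + 1) ^ 2 - x ^ 2) =
        of_nat (Suc m) ^ 2 / ((1 + (1 + x) / 2 + of_nat m) * (1 + (1 - x) / 2 + of_nat m))"
      by (simp only: mult_divide_mult_cancel_left_if) simp
    then have "(\<Prod>i = 1..Suc m. of_nat (2 * i) ^ 2 / (of_nat (2 * i + 1) ^ 2 - x ^ 2)) = ?f m *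
        (of_nat (Suc m) ^ 2 / ((1 + (1 + x) / 2 + of_nat m) * (1 + (1 - x) / 2 + of_nat m)))"
      using Suc by (simp only: prod.nat_ivl_Suc' mult.commute)
    then show ?case
      by (simp add: pochhammer_Suc power_mult_distrib mult_ac)
  qed simp
  obtain k where "n = Suc k" using assms by (cases n) auto
  then show ?thesis
    unfolding K_fun_def f
    by (simp add: sum.lessThan_Suc_shift sum.atLeast1_atMost_eq del: sum.lessThan_Suc)
qed

theorem proposition7p2:
  fixes n :: nat
  assumes "n \<ge> 1"
  shows "to_fract (hankel_det n (b_seq :: nat \<Rightarrow> 'a :: field_char_0 poly)) =
    (-1) ^ (n - 1) * (4 / (of_nat (fact n ^ 2) * (ratfun_X ^ 2 - 1))) * K_fun n ratfun_X *
      to_fract (hankel_det n (\<lambda>k. euler_poly_half (2 * k) :: 'a poly))"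
proof -
  define x :: "'a poly fract" where "x = ratfun_X"
  \<comment> \<open>The variable differs from every integer constant, so neither
    \<open>(1 + x)/2\<close> nor \<open>(1 - x)/2\<close> is a nonpositive integer and no rising
    factorial of them vanishes.\<close>
  have x_neq: "x \<noteq> r" if "r = of_nat m \<or> r = - of_nat m" for r m
  proof -
    have "[:0, 1:] \<noteq> (of_nat m :: 'a poly)" "[:0, 1:] \<noteq> - (of_nat m :: 'a poly)"
      by (simp_all add: of_nat_poly)
    then have "x \<noteq> to_fract (of_nat m)" "x \<noteq> to_fract (- of_nat m)"
      unfolding x_def ratfun_X_def to_fract_eq_iff by auto
    then show ?thesis using that by auto
  qed
  have nz: "pochhammer ((1 + x) / 2) k \<noteq> 0" "pochhammer ((1 - x) / 2) k \<noteq> 0" for k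
  proof -
    have "(1 + x) / 2 \<noteq> - of_nat m" for m
    proof
      assume "(1 + x) / 2 = - of_nat m"
      then have "1 + x = - (2 * of_nat m)" by (simp add: field_simps)
      then have "x = - (2 * of_nat m) - 1" by (metis add_diff_cancel_left')
      then show False using x_neq[of "- of_nat (Suc (2 * m))" "Suc (2 * m)"] by simp
    qed
    moreover have "(1 - x) / 2 \<noteq> - of_nat m" for m
      using x_neq[of "of_nat (Suc (2 * m))" "Suc (2 * m)"] by (auto simp: field_simps)
    ultimately show "pochhammer ((1 + x) / 2) k \<noteq> 0" "pochhammer ((1 - x) / 2) k \<noteq> 0"
      by (auto simp: pochhammer_eq_0_iff)
  qed
  have b_seq: "to_fract (b_seq k) =
      (if k = 0 then 0 else to_fract (euler_poly_half (2 * k - 2) :: 'a poly))" for k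
    by (simp add: b_seq_def)
  obtain k where k: "n = Suc k" using assms by (cases n) auto
  define y where "y = x ^ 2 - 1"
  \<comment> \<open>The minus sign turns \<open>(-1)^n\<close> into \<open>(-1)^(n - 1)\<close>, and
    the 4 moves to the numerator.\<close>
  have "(1 + x) / 2 * ((1 - x) / 2) = - y / 4"
    unfolding y_def by (simp add: field_simps power2_eq_square)
  then have factor: "(-1) ^ n / (fact n ^ 2 * ((1 + x) / 2 * ((1 - x) / 2))) =
      (-1) ^ (n - 1) * (4 / (of_nat (fact n ^ 2) * y))"
    by (simp only:) (simp add: k of_nat_power del: fact_Suc)
  have "(1 + x) / 2 + (1 - x) / 2 = 1" by (simp add: field_simps)
  note hankel_det_shifted_even[where e = "\<lambda>k. to_fract (euler_poly_half k :: 'a poly)" and n = n,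
    OF _ this nz, unfolded x_def, OF to_fract_euler_poly_half_recurrence, folded x_def]
  then show ?thesis
    unfolding to_fract_hankel_det b_seq K_fun_eq_sum[OF assms] x_def[symmetric] factor y_def .
qed

end
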